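(* For every nonrecursive r.e. set $B$ there is a nonrecursive r.e. set $A$ such that $A\le_{T(tu)}B$.
   Context: "Recursive" means computable, "r.e." means recursively enumerable. Sets are subsets of $\omega$, identified with elements of $\{0,1\}^\omega$; $A\upharpoonright n=A(0)\cdots A(n-1)$. An order function is a recursive nondecreasing unbounded function $h:\omega\to\omega$. Use: if $\Phi$ is a Turing reduction with $\Phi^B=A$, where before computing $\Phi^B(n)$ the machine first computes $\Phi^B(m)$ for all $m<n$, then the use function is $\varphi(n)=m+1$ where $m$ is the largest number queried while computing $A\upharpoonright n$ (and $0$ if there are no queries). $A\le_{T(tu)}B$ means: for every order function $h$ there is a Turing reduction of $A$ to $B$ whose use function is bounded by $h$. *)

theory Defs
  imports Main
begin

text \<open>
  Programs for oracle computation: Kleene's schemes of the partial recursive functions,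
  together with one further basic operation that queries the oracle. Programs act on lists of
  natural numbers; applied to a list of unsuitable length they have no value.
\<close>

datatype prog =
    Zero
  | Succ
  | Proj nat
  | Oracle
  | Comp prog "prog list"
  | PrimRec prog prog
  | Mu prog

text \<open>
  \<open>eval B p xs y Q\<close>: with oracle \<open>B\<close>, the computation of \<open>p\<close> on the arguments \<open>xs\<close>
  halts with value \<open>y\<close>, and \<open>Q\<close> is the set of all numbers about which it queried the oracle.
  Evaluation is strict: \<open>Comp\<close> evaluates all its arguments. \<open>PrimRec\<close> recurses on the first
  argument, and \<open>Mu\<close> tests \<open>0, 1, 2, \<dots>\<close> as first argument until the value \<open>0\<close> appears, so
  that the queries of unsuccessful tests are counted as well.
\<close>

inductive eval :: "nat set \<Rightarrow> prog \<Rightarrow> nat list \<Rightarrow> nat \<Rightarrow> nat set \<Rightarrow> bool" for B :: "nat set" where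
  eval_Zero: "eval B Zero xs 0 {}"
| eval_Succ: "eval B Succ [x] (Suc x) {}"
| eval_Proj: "i < length xs \<Longrightarrow> eval B (Proj i) xs (xs ! i) {}"
| eval_Oracle: "eval B Oracle [x] (of_bool (x \<in> B)) {x}"
| eval_Comp:
    "\<lbrakk>length ys = length gs;
      \<forall>i<length gs. eval B (gs ! i) xs (ys ! i) (Qs i);
      eval B f ys z Q\<rbrakk>
     \<Longrightarrow> eval B (Comp f gs) xs z ((\<Union>i<length gs. Qs i) \<union> Q)"
| eval_PrimRec_0:
    "eval B f xs y Q \<Longrightarrow> eval B (PrimRec f g) (0 # xs) y Q"
| eval_PrimRec_Suc:
    "\<lbrakk>eval B (PrimRec f g) (n # xs) r Q; eval B g (n # r # xs) y Q'\<rbrakk>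
     \<Longrightarrow> eval B (PrimRec f g) (Suc n # xs) y (Q \<union> Q')"
| eval_Mu:
    "\<lbrakk>\<forall>i<n. eval B f (i # xs) (Suc (vs i)) (Qs i); eval B f (n # xs) 0 Q\<rbrakk>
     \<Longrightarrow> eval B (Mu f) xs n ((\<Union>i<n. Qs i) \<union> Q)"

inductive_cases eval_ZeroE: "eval B Zero xs y Q"
inductive_cases eval_SuccE: "eval B Succ xs y Q"
inductive_cases eval_ProjE: "eval B (Proj i) xs y Q"
inductive_cases eval_OracleE: "eval B Oracle xs y Q"
inductive_cases eval_CompE: "eval B (Comp f gs) xs y Q"
inductive_cases eval_PrimRec_0E: "eval B (PrimRec f g) (0 # xs) y Q"
inductive_cases eval_PrimRec_SucE: "eval B (PrimRec f g) (Suc n # xs) y Q"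
inductive_cases eval_MuE: "eval B (Mu f) xs y Q"

lemma eval_finite_queries: "eval B p xs y Q \<Longrightarrow> finite Q"
  by (induction rule: eval.induct) auto

lemma eval_deterministic:
  "eval B p xs y Q \<Longrightarrow> eval B p xs y' Q' \<Longrightarrow> y' = y \<and> Q' = Q"
proof (induction arbitrary: y' Q' rule: eval.induct)
  case (eval_Comp ys gs xs Qs f z Q)
  from eval_Comp.prems obtain ys' Qs' Q1 where c:
    "length ys' = length gs" "\<forall>i<length gs. eval B (gs ! i) xs (ys' ! i) (Qs' i)"
    "eval B f ys' y' Q1" "Q' = (\<Union>i<length gs. Qs' i) \<union> Q1"
    by (rule eval_CompE)
  have e: "\<forall>i<length gs. ys' ! i = ys ! i \<and> Qs' i = Qs i"
    using eval_Comp.IH(1) c(2) by blast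
  then have "ys' = ys"
    using c(1) eval_Comp.hyps by (auto intro: nth_equalityI)
  with eval_Comp.IH(2) c(3) have "y' = z" "Q1 = Q" by auto
  with e c(4) show ?case by simp
next
  case (eval_Mu n f xs vs Qs Q)
  from eval_Mu.prems obtain vs' Qs' Q1 where c:
    "\<forall>i<y'. eval B f (i # xs) (Suc (vs' i)) (Qs' i)" "eval B f (y' # xs) 0 Q1"
    "Q' = (\<Union>i<y'. Qs' i) \<union> Q1"
    by (rule eval_MuE)
  have "\<not> n < y'"
  proof
    assume "n < y'"
    with c(1) have "eval B f (n # xs) (Suc (vs' n)) (Qs' n)" by simp
    from eval_Mu.IH(2)[OF this] show False by simp
  qed
  moreover have "\<not> y' < n"
  proof
    assume "y' < n"
    with eval_Mu.IH(1) c(2) have "0 = Suc (vs y') \<and> Q1 = Qs y'" by blast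
    then show False by simp
  qed
  ultimately have y': "y' = n" by simp
  have "\<forall>i<n. Qs' i = Qs i" using eval_Mu.IH(1) c(1) unfolding y' by blast
  moreover have "Q1 = Q" using eval_Mu.IH(2) c(2) unfolding y' by blast
  ultimately show ?case using c(3) y' by simp
next
  case (eval_PrimRec_Suc f g n xs r Q y Q2)
  from eval_PrimRec_Suc.prems obtain r' Q1 Q1' where c:
    "eval B (PrimRec f g) (n # xs) r' Q1" "eval B g (n # r' # xs) y' Q1'" "Q' = Q1 \<union> Q1'"
    by (rule eval_PrimRec_SucE)
  have r: "r' = r" "Q1 = Q" using eval_PrimRec_Suc.IH(1)[OF c(1)] by simp_all
  have "y' = y" "Q1' = Q2" using eval_PrimRec_Suc.IH(2) c(2) r(1) by simp_all
  with r c(3) show ?case by simp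
next
  case (eval_PrimRec_0 f xs y Q g)
  from eval_PrimRec_0.prems have "eval B f xs y' Q'" by (rule eval_PrimRec_0E)
  then show ?case by (rule eval_PrimRec_0.IH)
qed (blast elim: eval_ZeroE eval_SuccE eval_ProjE eval_OracleE)+

fun oracle_free :: "prog \<Rightarrow> bool" where
  "oracle_free Zero = True"
| "oracle_free Succ = True"
| "oracle_free (Proj i) = True"
| "oracle_free Oracle = False"
| "oracle_free (Comp f gs) = (oracle_free f \<and> (\<forall>g \<in> set gs. oracle_free g))"
| "oracle_free (PrimRec f g) = (oracle_free f \<and> oracle_free g)"
| "oracle_free (Mu f) = oracle_free f"

text \<open>The oracle \<open>{}\<close> below is a dummy, as the program makes no queries.\<close>

definition recursive_fun :: "(nat \<Rightarrow> nat) \<Rightarrow> bool" where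
  "recursive_fun h \<longleftrightarrow> (\<exists>p. oracle_free p \<and> (\<forall>n. eval {} p [n] (h n) {}))"

definition recursive_set :: "nat set \<Rightarrow> bool" where
  "recursive_set A \<longleftrightarrow> recursive_fun (\<lambda>n. of_bool (n \<in> A))"

definition re_set :: "nat set \<Rightarrow> bool" where
  "re_set A \<longleftrightarrow> A = {} \<or> (\<exists>f. recursive_fun f \<and> A = range f)"

definition order_function :: "(nat \<Rightarrow> nat) \<Rightarrow> bool" where
  "order_function h \<longleftrightarrow> recursive_fun h \<and> mono h \<and> (\<forall>k. \<exists>n. k \<le> h n)"

definition turing_reduction :: "prog \<Rightarrow> nat set \<Rightarrow> nat set \<Rightarrow> bool" where
  "turing_reduction \<Phi> A B \<longleftrightarrow> (\<forall>n. \<exists>Q. eval B \<Phi> [n] (of_bool (n \<in> A)) Q)"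

text \<open>
  The numbers queried while computing \<open>\<Phi>\<^sup>B(0), \<dots>, \<Phi>\<^sup>B(n-1)\<close>, that is, while computing the first
  \<open>n\<close> bits of \<open>\<Phi>\<^sup>B\<close>. Taking all these computations together has the same effect as the convention
  that a reduction computes its values at all smaller arguments first.
\<close>

definition queries_upto :: "prog \<Rightarrow> nat set \<Rightarrow> nat \<Rightarrow> nat set" where
  "queries_upto \<Phi> B n = {q. \<exists>m<n. \<exists>y Q. eval B \<Phi> [m] y Q \<and> q \<in> Q}"

definition use :: "prog \<Rightarrow> nat set \<Rightarrow> nat \<Rightarrow> nat" where
  "use \<Phi> B n = (if queries_upto \<Phi> B n = {} then 0 else Max (queries_upto \<Phi> B n) + 1)"

text \<open>\<open>Max\<close> is meaningful here:\<close>

lemma finite_queries_upto: "finite (queries_upto \<Phi> B n)"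
proof -
  have "finite {q. \<exists>y Q. eval B \<Phi> [m] y Q \<and> q \<in> Q}" for m
  proof (cases "\<exists>y Q. eval B \<Phi> [m] y Q")
    case True
    then obtain y Q where e: "eval B \<Phi> [m] y Q" by blast
    then have "{q. \<exists>y Q. eval B \<Phi> [m] y Q \<and> q \<in> Q} \<subseteq> Q"
      using eval_deterministic by blast
    then show ?thesis using eval_finite_queries[OF e] finite_subset by blast
  qed simp
  moreover have
    "queries_upto \<Phi> B n = (\<Union>m<n. {q. \<exists>y Q. eval B \<Phi> [m] y Q \<and> q \<in> Q})"
    by (auto simp: queries_upto_def)
  ultimately show ?thesis by simp
qed

text \<open>Turing reducibility with tiny use:\<close>

definition tu_reducible :: "nat set \<Rightarrow> nat set \<Rightarrow> bool" (infix "\<le>\<^sub>T\<^sub>t\<^sub>u" 50) where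
  "A \<le>\<^sub>T\<^sub>t\<^sub>u B \<longleftrightarrow>
     (\<forall>h. order_function h \<longrightarrow> (\<exists>\<Phi>. turing_reduction \<Phi> A B \<and> (\<forall>n. use \<Phi> B n \<le> h n)))"

end

theory Submission imports Defs "HOL-Library.Nat_Bijection" begin

text \<open>Let \<open>B\<close> be the range of a recursive \<open>f\<close>, so that \<open>f s\<close> enters \<open>B\<close> at stage \<open>s\<close> (unless it
  appeared before). The requirement \<open>e\<close>, that the complement of \<open>A\<close> is not \<open>W\<^sub>e\<close>, puts at most one
  number \<open>x = \<langle>e,y\<rangle>\<close> into \<open>A\<close>: it may do so at stage \<open>s\<close> if \<open>x\<close> is already in \<open>W\<^sub>e\<close> and a new \<open>k = f s\<close>
  permits it, which means that for each \<open>i < e\<close> the values \<open>p\<^sub>i 0, \<dots>, p\<^sub>i k\<close> of the \<open>i\<close>-th partial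
  recursive function that have been computed by stage \<open>s\<close> do not exceed \<open>x\<close>.

  If an order function \<open>h\<close> is given, take for \<open>p\<^sub>i\<close> an inverse of \<open>h\<close>. When \<open>p\<^sub>i 0, \<dots>, p\<^sub>i (h x)\<close> have
  been computed and \<open>B\<close> has settled below \<open>h x\<close>, only the finitely many requirements \<open>e \<le> i\<close> can
  still put \<open>x\<close> into \<open>A\<close>, so \<open>A\<close> is reducible to \<open>B\<close> with use bounded by \<open>h\<close>.

  For a fixed \<open>e\<close>, the numbers that a given \<open>k\<close> does not permit lie below \<open>g k\<close> for some recursive
  \<open>g\<close>: a total \<open>p\<^sub>i\<close> is recursive, and a partial one contributes only a constant, as just its initial
  segment of convergent values counts. If \<open>W\<^sub>e\<close> were the complement of \<open>A\<close>, then requirement \<open>e\<close> would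
  never act, so no \<open>k\<close> could enter \<open>B\<close> after \<open>\<langle>e,g k\<rangle>\<close> has entered \<open>W\<^sub>e\<close>, and \<open>B\<close> would be recursive.\<close>

section \<open>Evaluation\<close>

text \<open>Recursive functions are defined with the dummy oracle \<open>{}\<close>; this lets their
  programs run inside a reduction to another set.\<close>

lemma eval_oracle_free:
  "eval B p xs y Q \<Longrightarrow> oracle_free p \<Longrightarrow> Q = {} \<and> eval B' p xs y {}"
proof (induction rule: eval.induct)
  case (eval_Comp ys gs xs Qs f z Q)
  then have "\<forall>i<length gs. Qs i = {} \<and> eval B' (gs ! i) xs (ys ! i) {}" by auto
  then show ?case
    using eval.eval_Comp[of ys gs B' xs "\<lambda>_. {}" f z "{}"] eval_Comp by auto
next
  case (eval_PrimRec_Suc f g n xs r Q y Q')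
  then show ?case using eval.eval_PrimRec_Suc[of B' f g n xs r "{}" y "{}"] by auto
next
  case (eval_Mu n f xs vs Qs Q)
  then have "\<forall>i<n. Qs i = {} \<and> eval B' f (i # xs) (Suc (vs i)) {}" by auto
  then show ?case
    using eval.eval_Mu[of n B' f xs vs "\<lambda>_. {}" "{}"] eval_Mu by auto
qed (auto intro: eval.intros)

lemma eval_Comp_pure:
  "\<lbrakk>length ys = length gs; \<And>i. i < length gs \<Longrightarrow> eval B (gs ! i) xs (ys ! i) {};
    eval B f ys z Q\<rbrakk> \<Longrightarrow> eval B (Comp f gs) xs z Q"
  using eval_Comp[of ys gs B xs "\<lambda>_. {}" f z Q] by auto

lemma eval_Comp1:
  "eval B g xs y Q \<Longrightarrow> eval B f [y] z Q' \<Longrightarrow> eval B (Comp f [g]) xs z (Q \<union> Q')"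
  using eval_Comp[of "[y]" "[g]" B xs "\<lambda>_. Q" f z Q'] by (simp add: lessThan_Suc)

lemma eval_Comp2:
  "eval B g xs y Q \<Longrightarrow> eval B g' xs y' Q' \<Longrightarrow> eval B f [y, y'] z Q''
   \<Longrightarrow> eval B (Comp f [g, g']) xs z (Q \<union> Q' \<union> Q'')"
  using eval_Comp[of "[y, y']" "[g, g']" B xs "case_nat Q (\<lambda>_. Q')" f z Q'']
  by (simp add: All_less_Suc2 lessThan_Suc_eq_insert_0 ac_simps)

lemma eval_Mu_pure:
  assumes p: "\<And>y. eval B p (y # xs) (v y) {}" and ex: "\<exists>y. v y = 0"
  shows "eval B (Mu p) xs (LEAST y. v y = 0) {}"
proof -
  let ?n = "LEAST y. v y = 0"
  have 0: "v ?n = 0" using ex by (rule LeastI_ex)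
  have "v i \<noteq> 0" if "i < ?n" for i using not_less_Least[OF that] .
  then have "\<forall>i<?n. eval B p (i # xs) (Suc (v i - 1)) {}"
    using p by (metis Suc_pred' neq0_conv)
  from eval_Mu[OF this, of "{}"] show ?thesis using p[of ?n] 0 by simp
qed

section \<open>A calculus of recursive functions\<close>

text \<open>Using environments instead of argument lists, the arity need not be tracked and
  variables bound by a quantifier are handled by shifting.\<close>

definition computes :: "prog \<Rightarrow> nat \<Rightarrow> ((nat \<Rightarrow> nat) \<Rightarrow> nat) \<Rightarrow> bool" where
  "computes p k F \<longleftrightarrow> oracle_free p \<and> (\<forall>e. eval {} p (map e [0..<k]) (F e) {})"

definition rc :: "((nat \<Rightarrow> nat) \<Rightarrow> nat) \<Rightarrow> bool" where
  "rc F \<longleftrightarrow> (\<exists>p k. computes p k F)"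

definition rp :: "((nat \<Rightarrow> nat) \<Rightarrow> bool) \<Rightarrow> bool" where
  "rp P \<longleftrightarrow> rc (\<lambda>e. of_bool (P e))"

lemma computes_raise:
  assumes "computes p k F" "k \<le> k'"
  shows "computes (Comp p (map Proj [0..<k])) k' F"
  unfolding computes_def
proof (intro conjI allI)
  show "oracle_free (Comp p (map Proj [0..<k]))" using assms by (auto simp: computes_def)
  fix e
  show "eval {} (Comp p (map Proj [0..<k])) (map e [0..<k']) (F e) {}"
  proof (rule eval_Comp_pure)
    show "eval {} p (map e [0..<k]) (F e) {}" using assms by (auto simp: computes_def)
    fix i assume "i < length (map Proj [0..<k])"
    then show "eval {} (map Proj [0..<k] ! i) (map e [0..<k']) (map e [0..<k] ! i) {}"
      using eval_Proj[of i "map e [0..<k']" "{}"] assms(2) by simp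
  qed simp
qed

lemma rc_arity: "rc F \<Longrightarrow> \<exists>k. \<forall>k'\<ge>k. \<exists>p. computes p k' F"
  unfolding rc_def using computes_raise by blast

lemma rc_subst:
  assumes "rc F" and G: "\<And>i. rc (G i)"
  shows "rc (\<lambda>e. F (\<lambda>i. G i e))"
proof -
  obtain p k where p: "computes p k F" using assms(1) by (auto simp: rc_def)
  have "\<forall>i. \<exists>k. \<forall>k'\<ge>k. \<exists>p. computes p k' (G i)" using rc_arity[OF G] by blast
  then obtain K where K: "\<And>i k'. k' \<ge> K i \<Longrightarrow> \<exists>p. computes p k' (G i)" by metis
  \<comment> \<open>Only the first \<open>k\<close> substituted functions matter; the sum of their
    arity thresholds is a common arity.\<close>
  define M where "M = (\<Sum>i<k. K i)"
  have "\<exists>p. computes p M (G i)" if "i < k" for i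
    by (rule K) (use that in \<open>simp add: M_def member_le_sum\<close>)
  then obtain g where g: "\<And>i. i < k \<Longrightarrow> computes (g i) M (G i)" by metis
  have "computes (Comp p (map g [0..<k])) M (\<lambda>e. F (\<lambda>i. G i e))"
    unfolding computes_def
  proof (intro conjI allI)
    show "oracle_free (Comp p (map g [0..<k]))" using p g by (auto simp: computes_def)
    fix e
    show "eval {} (Comp p (map g [0..<k])) (map e [0..<M]) (F (\<lambda>i. G i e)) {}"
      by (rule eval_Comp_pure[of "map (\<lambda>i. G i e) [0..<k]"])
        (use p g in \<open>auto simp: computes_def\<close>)
  qed
  then show ?thesis by (auto simp: rc_def)
qed

lemma rc_proj: "rc (\<lambda>e. e i)"
  unfolding rc_def computes_def
  using eval_Proj[of i "map _ [0..<Suc i]" "{}"]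
  by (intro exI[of _ "Proj i"] exI[of _ "Suc i"]) (auto simp del: upt_Suc)

lemma rc_shift: "rc E \<Longrightarrow> rc (\<lambda>e. E (\<lambda>i. e (Suc i)))"
  by (rule rc_subst[of E "\<lambda>i e. e (Suc i)"]) (auto intro: rc_proj)

lemma rc_app1:
  assumes "rc (\<lambda>e. f (e 0))" "rc E"
  shows "rc (\<lambda>e. f (E e))"
  using rc_subst[OF assms(1), of "\<lambda>_. E"] assms(2) by simp

lemma rc_app2:
  assumes "rc (\<lambda>e. f (e 0) (e 1))" "rc E" "rc E'"
  shows "rc (\<lambda>e. f (E e) (E' e))"
  using rc_subst[OF assms(1), of "\<lambda>i. if i = 0 then E else E'"] assms(2,3) by simp

lemma rc_app3:
  assumes "rc (\<lambda>e. f (e 0) (e 1) (e 2))" "rc E" "rc E'" "rc E''"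
  shows "rc (\<lambda>e. f (E e) (E' e) (E'' e))"
  using rc_subst[OF assms(1), of "\<lambda>i. if i = 0 then E else if i = 1 then E' else E''"] assms(2-)
  by simp

lemma rp_app1:
  assumes "rp (\<lambda>e. P (e 0))" "rc E"
  shows "rp (\<lambda>e. P (E e))"
  using assms rc_app1[of "\<lambda>x. of_bool (P x)"] by (simp add: rp_def)

lemma rp_app2:
  assumes "rp (\<lambda>e. P (e 0) (e 1))" "rc E" "rc E'"
  shows "rp (\<lambda>e. P (E e) (E' e))"
  using assms rc_app2[of "\<lambda>x y. of_bool (P x y)"] by (simp add: rp_def)

lemma rp_app3:
  assumes "rp (\<lambda>e. P (e 0) (e 1) (e 2))" "rc E" "rc E'" "rc E''"
  shows "rp (\<lambda>e. P (E e) (E' e) (E'' e))"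
  using assms rc_app3[of "\<lambda>x y z. of_bool (P x y z)"] by (simp add: rp_def)

text \<open>Only finitely many variables matter, so those beyond the list may repeat its last entry.\<close>

lemma rc_program:
  assumes "rc F"
  shows "\<exists>p. oracle_free p \<and>
    (\<forall>B xs. length xs = Suc n \<longrightarrow> eval B p xs (F (\<lambda>i. xs ! min i n)) {})"
proof -
  obtain p k where p: "computes p k F" using assms by (auto simp: rc_def)
  let ?p = "Comp p (map (\<lambda>i. Proj (min i n)) [0..<k])"
  have "eval {} ?p xs (F (\<lambda>i. xs ! min i n)) {}" if "length xs = Suc n" for xs
    by (rule eval_Comp_pure[of "map (\<lambda>i. xs ! min i n) [0..<k]"])
      (use p that in \<open>auto simp: computes_def intro!: eval_Proj\<close>)
  moreover have "oracle_free ?p" using p by (auto simp: computes_def)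
  ultimately show ?thesis using eval_oracle_free by blast
qed

lemma recursive_fun_rc: "recursive_fun h \<longleftrightarrow> rc (\<lambda>e. h (e 0))"
proof
  assume "recursive_fun h"
  then obtain p where p: "oracle_free p" "\<And>n. eval {} p [n] (h n) {}"
    by (auto simp: recursive_fun_def)
  then have "computes p 1 (\<lambda>e. h (e 0))" by (auto simp: computes_def)
  then show "rc (\<lambda>e. h (e 0))" by (auto simp: rc_def)
next
  assume "rc (\<lambda>e. h (e 0))"
  from rc_program[OF this, of 0] obtain p where
    "oracle_free p" "\<And>xs. length xs = 1 \<Longrightarrow> eval {} p xs (h (xs ! 0)) {}" by auto
  then show "recursive_fun h" by (auto simp: recursive_fun_def intro!: exI[of _ p])
      (metis One_nat_def length_Cons list.size(3) nth_Cons_0)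
qed

lemma recursive_set_rp: "recursive_set A \<longleftrightarrow> rp (\<lambda>e. e 0 \<in> A)"
  by (simp add: recursive_set_def recursive_fun_rc rp_def)

lemma rc_Suc: "rc E \<Longrightarrow> rc (\<lambda>e. Suc (E e))"
proof (rule rc_app1[of Suc])
  have "computes Succ 1 (\<lambda>e. Suc (e 0))" by (auto simp: computes_def intro: eval.intros)
  then show "rc (\<lambda>e. Suc (e 0))" by (auto simp: rc_def)
qed

lemma rc_const: "rc (\<lambda>e. c)"
proof (induction c)
  case 0
  have "computes Zero 0 (\<lambda>e. 0)" by (auto simp: computes_def intro: eval.intros)
  then show ?case by (auto simp: rc_def)
qed (rule rc_Suc)

lemma map_env: "map e [0..<Suc k] = e 0 # map (\<lambda>i. e (Suc i)) [0..<k]"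
  by (simp add: upt_conv_Cons map_Suc_upt[symmetric] del: upt_Suc)

lemma rc_rec:
  assumes F: "rc F" and G: "rc (\<lambda>e. G (e 0) (e 1) (\<lambda>i. e (Suc (Suc i))))" and N: "rc N"
  shows "rc (\<lambda>e. rec_nat (F e) (\<lambda>n r. G n r e) (N e))"
proof -
  obtain k1 where k1: "\<And>k. k \<ge> k1 \<Longrightarrow> \<exists>p. computes p k F" using rc_arity[OF F] by blast
  obtain k2 where k2: "\<And>k. k \<ge> k2 \<Longrightarrow> \<exists>p. computes p k (\<lambda>e. G (e 0) (e 1) (\<lambda>i. e (Suc (Suc i))))"
    using rc_arity[OF G] by blast
  obtain p where p: "computes p (k1 + k2) F" using k1 by (meson le_add1)
  obtain q where q: "computes q (Suc (Suc (k1 + k2))) (\<lambda>e. G (e 0) (e 1) (\<lambda>i. e (Suc (Suc i))))"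
    using k2[of "Suc (Suc (k1 + k2))"] by auto
  have q': "eval {} q (n # r # map e [0..<k1+k2]) (G n r e) {}" for n r e
  proof -
    have "eval {} q (map e' [0..<Suc (Suc (k1 + k2))]) (G (e' 0) (e' 1) (\<lambda>i. e' (Suc (Suc i)))) {}" for e'
      using q by (simp add: computes_def)
    from this[of "case_nat n (case_nat r e)"] show ?thesis by (simp add: map_env del: upt_Suc)
  qed
  have ev: "eval {} (PrimRec p q) (n # map e [0..<k1+k2]) (rec_nat (F e) (\<lambda>n r. G n r e) n) {}" for n e
  proof (induction n)
    case 0
    then show ?case using p by (auto simp: computes_def intro: eval.intros)
  next
    case (Suc n)
    then show ?case using eval_PrimRec_Suc[OF Suc q'] by simp
  qed
  have "computes (PrimRec p q) (Suc (k1 + k2))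
          (\<lambda>e. rec_nat (F (\<lambda>i. e (Suc i))) (\<lambda>n r. G n r (\<lambda>i. e (Suc i))) (e 0))"
    using p q ev by (auto simp: computes_def map_env simp del: upt_Suc)
  then have "rc (\<lambda>e. rec_nat (F (\<lambda>i. e (Suc i))) (\<lambda>n r. G n r (\<lambda>i. e (Suc i))) (e 0))"
    by (auto simp: rc_def)
  \<comment> \<open>The recursion argument was variable 0, with the parameters shifted up;
    substituting \<open>N\<close> for it shifts them back.\<close>
  from rc_subst[OF this, of "case_nat N (\<lambda>i e. e i)"] show ?thesis
    using N by (simp add: rc_proj split: nat.split)
qed

lemma rc_mu:
  assumes P: "rc (\<lambda>e. P (e 0) (\<lambda>i. e (Suc i)))" and ex: "\<And>e. \<exists>y. P y e = 0"
  shows "rc (\<lambda>e. LEAST y. P y e = 0)"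
proof -
  obtain k where "\<And>k'. k' \<ge> k \<Longrightarrow> \<exists>p. computes p k' (\<lambda>e. P (e 0) (\<lambda>i. e (Suc i)))"
    using rc_arity[OF P] by blast
  then obtain p where p: "computes p (Suc k) (\<lambda>e. P (e 0) (\<lambda>i. e (Suc i)))" by (meson le_SucI order_refl)
  have p': "eval {} p (y # map e [0..<k]) (P y e) {}" for y e
  proof -
    have "eval {} p (map e' [0..<Suc k]) (P (e' 0) (\<lambda>i. e' (Suc i))) {}" for e'
      using p by (simp add: computes_def)
    from this[of "case_nat y e"] show ?thesis by (simp add: map_env del: upt_Suc)
  qed
  have "eval {} (Mu p) (map e [0..<k]) (LEAST y. P y e = 0) {}" for e
    using p' ex by (rule eval_Mu_pure)
  then have "computes (Mu p) k (\<lambda>e. LEAST y. P y e = 0)" using p by (auto simp: computes_def)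
  then show ?thesis by (auto simp: rc_def)
qed

lemma rc_if:
  assumes "rp P" "rc F" "rc G"
  shows "rc (\<lambda>e. if P e then F e else G e)"
proof -
  \<comment> \<open>Case distinction as a primitive recursion of length 0 or 1.\<close>
  have "rc (\<lambda>e. rec_nat (G e) (\<lambda>n r. F e) (of_bool (P e)))"
    using assms by (intro rc_rec rc_shift[OF rc_shift[OF assms(2)]]) (simp_all add: rp_def)
  moreover have "rec_nat (G e) (\<lambda>n r. F e) (of_bool (P e)) = (if P e then F e else G e)" for e
    by simp
  ultimately show ?thesis by simp
qed

section \<open>Decidable predicates and arithmetic\<close>

lemma rp_const: "rp (\<lambda>e. c)"
  unfolding rp_def by (rule rc_const)

lemma rp_if: "rp P \<Longrightarrow> rp Q \<Longrightarrow> rp R \<Longrightarrow> rp (\<lambda>e. if P e then Q e else R e)"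
  using rc_if[of P "\<lambda>e. of_bool (Q e)" "\<lambda>e. of_bool (R e)"]
  by (simp add: rp_def if_distrib[of of_bool])

lemma rp_cong: "rp P \<Longrightarrow> (\<And>e. P e \<longleftrightarrow> Q e) \<Longrightarrow> rp Q"
  by (subgoal_tac "P = Q") auto

lemma rp_not: "rp P \<Longrightarrow> rp (\<lambda>e. \<not> P e)"
  by (rule rp_cong[OF rp_if[OF _ rp_const[of False] rp_const[of True]]]) auto

lemma rp_conj: "rp P \<Longrightarrow> rp Q \<Longrightarrow> rp (\<lambda>e. P e \<and> Q e)"
  by (rule rp_cong[OF rp_if[of P Q, OF _ _ rp_const[of False]]]) auto

lemma rp_disj: "rp P \<Longrightarrow> rp Q \<Longrightarrow> rp (\<lambda>e. P e \<or> Q e)"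
  using rp_not[OF rp_conj[OF rp_not rp_not, of P Q]] by simp

lemma rp_imp: "rp P \<Longrightarrow> rp Q \<Longrightarrow> rp (\<lambda>e. P e \<longrightarrow> Q e)"
  using rp_disj[OF rp_not, of P Q] by simp

lemma rp_zero: assumes "rc E" shows "rp (\<lambda>e. E e = 0)"
proof -
  have "rc (\<lambda>e. rec_nat (Suc 0) (\<lambda>n r. 0) (E e))" by (intro rc_rec rc_const assms)
  moreover have "rec_nat (Suc 0) (\<lambda>n r. 0) x = of_bool (x = (0::nat))" for x by (cases x) auto
  ultimately show ?thesis by (simp add: rp_def)
qed

lemma rc_add: assumes "rc E" "rc F" shows "rc (\<lambda>e. E e + F e)"
proof -
  have "rc (\<lambda>e. rec_nat (E e) (\<lambda>n r. Suc r) (F e))" by (intro rc_rec rc_Suc rc_proj assms)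
  moreover have "rec_nat x (\<lambda>n r. Suc r) y = x + y" for x y by (induction y) auto
  ultimately show ?thesis by simp
qed

lemma rc_mult: assumes "rc E" "rc F" shows "rc (\<lambda>e. E e * F e)"
proof -
  have "rc (\<lambda>e. rec_nat 0 (\<lambda>n r. r + E e) (F e))"
    by (rule rc_rec) (intro rc_add rc_proj rc_const assms rc_shift[OF rc_shift[OF assms(1)]])+
  moreover have "rec_nat 0 (\<lambda>n r. r + x) y = x * y" for x y :: nat by (induction y) auto
  ultimately show ?thesis by simp
qed

lemma rc_power: assumes "rc E" shows "rc (\<lambda>e. 2 ^ E e)"
proof -
  have "rc (\<lambda>e. rec_nat 1 (\<lambda>n r. r + r) (E e))" by (intro rc_rec rc_add rc_proj rc_const assms)
  moreover have "rec_nat 1 (\<lambda>n r. r + r) x = (2::nat) ^ x" for x by (induction x) auto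
  ultimately show ?thesis by simp
qed

lemma rc_diff: assumes "rc E" "rc F" shows "rc (\<lambda>e. E e - F e)"
proof -
  have pred: "rc (\<lambda>e. rec_nat 0 (\<lambda>n r. n) (e 0))" by (intro rc_rec rc_proj rc_const)
  have p: "rec_nat 0 (\<lambda>n r. n) x = x - 1" for x by (cases x) auto
  have "rc (\<lambda>e. rec_nat (E e) (\<lambda>n r. r - 1) (F e))"
    by (rule rc_rec) (intro rc_app1[OF pred[unfolded p]] rc_proj assms)+
  moreover have "rec_nat x (\<lambda>n r. r - 1) y = x - y" for x y :: nat by (induction y) auto
  ultimately show ?thesis by simp
qed

lemma rp_le: "rc E \<Longrightarrow> rc F \<Longrightarrow> rp (\<lambda>e. E e \<le> F e)"
  using rp_zero[OF rc_diff, of E F] by simp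

lemma rp_less: "rc E \<Longrightarrow> rc F \<Longrightarrow> rp (\<lambda>e. E e < F e)"
  using rp_le[OF rc_Suc, of E F] by (simp add: Suc_le_eq)

lemma rp_eq: "rc E \<Longrightarrow> rc F \<Longrightarrow> rp (\<lambda>e. E e = F e)"
  using rp_conj[OF rp_le rp_le, of E F F E] by (simp add: eq_iff)

lemma rc_Least:
  assumes "rp (\<lambda>e. P (e 0) (\<lambda>i. e (Suc i)))" "\<And>e. \<exists>y. P y e"
  shows "rc (\<lambda>e. LEAST y. P y e)"
  using rc_mu[of "\<lambda>y e. of_bool (\<not> P y e)"] rp_not[OF assms(1)] assms(2) by (simp add: rp_def)

lemma rp_ex_less:
  assumes P: "rp (\<lambda>e. P (e 0) (\<lambda>i. e (Suc i)))" and N: "rc N"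
  shows "rp (\<lambda>e. \<exists>y<N e. P y e)"
proof -
  \<comment> \<open>The disjunct \<open>N e \<le> y\<close> makes the search total; the result is
    below \<open>N e\<close> only at a genuine witness.\<close>
  have "rp (\<lambda>e. (LEAST y. P y e \<or> N e \<le> y) < N e)"
    by (intro rp_less N rc_Least rp_disj P rp_le rc_shift[OF N] rc_proj) auto
  moreover have "(LEAST y. P y e \<or> N e \<le> y) < N e \<longleftrightarrow> (\<exists>y<N e. P y e)" for e
  proof
    assume "(LEAST y. P y e \<or> N e \<le> y) < N e"
    moreover have "P (LEAST y. P y e \<or> N e \<le> y) e \<or> N e \<le> (LEAST y. P y e \<or> N e \<le> y)"
      by (rule LeastI[of "\<lambda>y. P y e \<or> N e \<le> y" "N e"]) simp
    ultimately show "\<exists>y<N e. P y e" by auto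
  next
    assume "\<exists>y<N e. P y e"
    then show "(LEAST y. P y e \<or> N e \<le> y) < N e"
      by (auto intro: le_less_trans[OF Least_le])
  qed
  ultimately show ?thesis by simp
qed

lemma rp_all_less:
  assumes "rp (\<lambda>e. P (e 0) (\<lambda>i. e (Suc i)))" "rc N"
  shows "rp (\<lambda>e. \<forall>y<N e. P y e)"
  using rp_not[OF rp_ex_less[OF rp_not, of "P" N]] assms by simp

lemma rp_ex_le:
  assumes "rp (\<lambda>e. P (e 0) (\<lambda>i. e (Suc i)))" "rc N"
  shows "rp (\<lambda>e. \<exists>y\<le>N e. P y e)"
  using rp_ex_less[OF assms(1) rc_Suc[OF assms(2)]] by (simp add: less_Suc_eq_le)

lemma rp_all_le:
  assumes "rp (\<lambda>e. P (e 0) (\<lambda>i. e (Suc i)))" "rc N"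
  shows "rp (\<lambda>e. \<forall>y\<le>N e. P y e)"
  using rp_all_less[OF assms(1) rc_Suc[OF assms(2)]] by (simp add: less_Suc_eq_le)

text \<open>This form matches the quantifiers of \<open>justified\<close> when its bound is
  \<open>{..<w}\<close>.\<close>

lemma rp_bex_less:
  assumes "rp (\<lambda>e. P (e 0) (\<lambda>i. e (Suc i)))" "rc N"
  shows "rp (\<lambda>e. \<exists>y\<in>{..<N e}. P y e)"
  using rp_ex_less[OF assms] by (simp add: Bex_def)

lemma rc_div: assumes "rc E" "rc F" shows "rc (\<lambda>e. E e div F e)"
proof -
  have ex: "\<exists>q. y = 0 \<or> x < y * Suc q" for x y :: nat
    by (rule exI[of _ x]) (cases y; simp)
  \<comment> \<open>For \<open>F e = 0\<close> the search stops at 0, in agreement with division by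
    zero in HOL.\<close>
  have "rc (\<lambda>e. LEAST q. F e = 0 \<or> E e < F e * Suc q)"
    by (intro rc_Least rp_disj rp_zero rp_less rc_mult rc_Suc rc_proj ex
        rc_shift[OF assms(1)] rc_shift[OF assms(2)])
  moreover have "(LEAST q. y = 0 \<or> x < y * Suc q) = x div y" for x y :: nat
  proof (cases "y = 0")
    case False
    then show ?thesis
      by (intro Least_equality)
        (auto simp: dividend_less_times_div less_mult_imp_div_less mult.commute
          simp flip: less_Suc_eq_le)
  qed simp
  ultimately show ?thesis by simp
qed

lemma rc_pair: assumes "rc E" "rc F" shows "rc (\<lambda>e. prod_encode (E e, F e))"
  unfolding prod_encode_def triangle_def
  using assms by (auto intro!: rc_add rc_div rc_mult rc_Suc rc_const)

lemma rp_in_set_decode: assumes "rc E" "rc F" shows "rp (\<lambda>e. E e \<in> set_decode (F e))"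
proof -
  have "rp (\<lambda>e. \<exists>q<e 0. e 0 = Suc (2 * q))"
    by (intro rp_ex_less rp_eq rc_Suc rc_mult rc_proj rc_const)
  moreover have "(\<exists>q<x. x = Suc (2 * q)) \<longleftrightarrow> odd x" for x :: nat by (auto elim!: oddE)
  ultimately have "rp (\<lambda>e. odd (e 0))" by simp
  from rp_app1[of odd, OF this rc_div[OF assms(2) rc_power[OF assms(1)]]]
  show ?thesis by (simp add: set_decode_def)
qed

section \<open>A universal enumeration\<close>

abbreviation pair :: "nat \<Rightarrow> nat \<Rightarrow> nat" ("\<langle>_,_\<rangle>") where
  "\<langle>x,y\<rangle> \<equiv> prod_encode (x, y)"

abbreviation cons :: "nat \<Rightarrow> nat \<Rightarrow> nat" where
  "cons x a \<equiv> Suc \<langle>x,a\<rangle>"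

abbreviation fact_code :: "nat \<Rightarrow> nat \<Rightarrow> nat \<Rightarrow> nat" where
  "fact_code c a y \<equiv> \<langle>c,\<langle>a,y\<rangle>\<rangle>"

text \<open>Tag 6 is kept free for lists of programs. Tag 7 appears in no clause of
  \<open>justified\<close>, so no fact about \<open>Oracle\<close> is ever justified.\<close>

primrec pcode :: "prog \<Rightarrow> nat" where
  "pcode Zero = \<langle>0,0\<rangle>"
| "pcode Succ = \<langle>1,0\<rangle>"
| "pcode (Proj i) = \<langle>2,i\<rangle>"
| "pcode (Comp f gs) = \<langle>3,\<langle>pcode f,list_encode (map pcode gs)\<rangle>\<rangle>"
| "pcode (PrimRec f g) = \<langle>4,\<langle>pcode f,pcode g\<rangle>\<rangle>"
| "pcode (Mu f) = \<langle>5,pcode f\<rangle>"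
| "pcode Oracle = \<langle>7,0\<rangle>"

text \<open>A computation is represented by a set of facts \<open>p(xs) = y\<close>, each of which follows by one
  step from others in the set. The steps are well-founded, since each leads to a subprogram or to
  a smaller recursion argument, so no order on the facts need be recorded. The codes \<open>\<langle>6,gs\<rangle>\<close> stand
  for lists of programs evaluated componentwise. \<open>N\<close> bounds the quantifiers, to make the
  notion decidable.\<close>

definition justified :: "nat set \<Rightarrow> nat set \<Rightarrow> nat \<Rightarrow> nat \<Rightarrow> nat \<Rightarrow> bool" where
  "justified N S c a y \<longleftrightarrow>
     c = \<langle>0,0\<rangle> \<and> y = 0 \<or>
     c = \<langle>1,0\<rangle> \<and> (\<exists>x\<in>N. a = cons x 0 \<and> y = Suc x) \<or>
     c = \<langle>2,0\<rangle> \<and> (\<exists>b\<in>N. a = cons y b) \<or>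
     (\<exists>i\<in>N. c = \<langle>2,Suc i\<rangle> \<and> (\<exists>x\<in>N. \<exists>b\<in>N. a = cons x b \<and> fact_code \<langle>2,i\<rangle> b y \<in> S)) \<or>
     (\<exists>f\<in>N. \<exists>L\<in>N. c = \<langle>3,\<langle>f,L\<rangle>\<rangle> \<and>
        (\<exists>b\<in>N. fact_code \<langle>6,L\<rangle> a b \<in> S \<and> fact_code f b y \<in> S)) \<or>
     c = \<langle>6,0\<rangle> \<and> y = 0 \<or>
     (\<exists>g\<in>N. \<exists>L\<in>N. c = \<langle>6,cons g L\<rangle> \<and>
        (\<exists>u\<in>N. \<exists>v\<in>N. y = cons u v \<and> fact_code g a u \<in> S \<and> fact_code \<langle>6,L\<rangle> a v \<in> S)) \<or>
     (\<exists>f\<in>N. \<exists>g\<in>N. c = \<langle>4,\<langle>f,g\<rangle>\<rangle> \<and>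
        ((\<exists>b\<in>N. a = cons 0 b \<and> fact_code f b y \<in> S) \<or>
         (\<exists>m\<in>N. \<exists>b\<in>N. a = cons (Suc m) b \<and>
            (\<exists>r\<in>N. fact_code c (cons m b) r \<in> S \<and> fact_code g (cons m (cons r b)) y \<in> S)))) \<or>
     (\<exists>f\<in>N. c = \<langle>5,f\<rangle> \<and> fact_code f (cons y a) 0 \<in> S \<and>
        (\<forall>i<y. \<exists>v\<in>N. fact_code f (cons i a) (Suc v) \<in> S))"

definition closed_facts :: "nat set \<Rightarrow> bool" where
  "closed_facts S \<longleftrightarrow> (\<forall>c a y. fact_code c a y \<in> S \<longrightarrow> justified UNIV S c a y)"

lemma justified_mono: "justified N S c a y \<Longrightarrow> N \<subseteq> N' \<Longrightarrow> S \<subseteq> S' \<Longrightarrow> justified N' S' c a y"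
  unfolding justified_def by (elim disj_forward conj_forward bexE; blast)

lemma list_encode_eq_cons: "list_encode xs = cons x b \<longleftrightarrow> xs = x # list_decode b"
  by (cases xs) auto

text \<open>Induction on the program, with inner inductions on the projection index, the list of
  programs and the recursion argument, excludes circular justifications.\<close>

lemma closed_facts_sound:
  "\<lbrakk>closed_facts S; fact_code (pcode p) (list_encode xs) y \<in> S\<rbrakk> \<Longrightarrow> eval {} p xs y {}"
proof (induction p arbitrary: xs y)
  have J: "justified UNIV S c a y" if "closed_facts S" "fact_code c a y \<in> S" for c a y
    using that by (auto simp: closed_facts_def)
  {
    case Zero
    from J[OF Zero] show ?case by (auto simp: justified_def intro: eval.intros)
  next
    case Succ
    from J[OF Succ] show ?case
      by (auto simp: justified_def list_encode_eq_cons intro: eval.intros)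
  next
    case (Proj i)
    have "i < length xs \<and> y = xs ! i"
      using Proj(2)
    proof (induction i arbitrary: xs)
      case 0
      from J[OF Proj(1) this] show ?case by (auto simp: justified_def list_encode_eq_cons)
    next
      case (Suc i)
      from J[OF Proj(1) Suc(2)] obtain x b where
        "xs = x # list_decode b" "fact_code \<langle>2,i\<rangle> b y \<in> S"
        by (auto simp: justified_def list_encode_eq_cons)
      then show ?case using Suc(1)[of "list_decode b"] by auto
    qed
    then show ?case by (auto intro: eval.intros)
  next
    case (Comp f gs)
    have list: "\<exists>ys. b = list_encode ys \<and> length ys = length hs \<and>
                  (\<forall>i<length hs. eval {} (hs ! i) xs (ys ! i) {})"
      if "fact_code \<langle>6,list_encode (map pcode hs)\<rangle> (list_encode xs) b \<in> S" "set hs \<subseteq> set gs" for b hs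
      using that
    proof (induction hs arbitrary: b)
      case Nil
      from J[OF Comp(3) Nil(1)] have "b = 0" by (auto simp: justified_def)
      then show ?case by (intro exI[of _ "[]"]) simp
    next
      case (Cons h hs)
      from J[OF Comp(3) Cons(2)] obtain u v where uv: "b = cons u v"
        "fact_code (pcode h) (list_encode xs) u \<in> S"
        "fact_code \<langle>6,list_encode (map pcode hs)\<rangle> (list_encode xs) v \<in> S"
        by (auto simp: justified_def)
      from Cons(1)[OF uv(3)] Cons(3) obtain ys where
        ys: "v = list_encode ys" "length ys = length hs" "\<forall>i<length hs. eval {} (hs ! i) xs (ys ! i) {}"
        by auto
      have "eval {} h xs u {}" using Comp(2)[OF _ Comp(3) uv(2)] Cons(3) by simp
      then show ?case using ys uv(1)
        by (intro exI[of _ "u # ys"]) (auto simp: less_Suc_eq_0_disj)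
    qed
    from J[OF Comp(3,4)] obtain b where b:
      "fact_code \<langle>6,list_encode (map pcode gs)\<rangle> (list_encode xs) b \<in> S" "fact_code (pcode f) b y \<in> S"
      by (auto simp: justified_def)
    from list[OF b(1)] obtain ys where ys: "b = list_encode ys" "length ys = length gs"
      "\<forall>i<length gs. eval {} (gs ! i) xs (ys ! i) {}" by auto
    show ?case
      by (rule eval_Comp_pure[OF ys(2)]) (use ys(3) Comp(1)[OF Comp(3)] b(2) ys(1) in auto)
  next
    case (PrimRec f g)
    have rec: "eval {} (PrimRec f g) (m # bs) y {}"
      if "fact_code (pcode (PrimRec f g)) (list_encode (m # bs)) y \<in> S" for m bs y
      using that
    proof (induction m arbitrary: y)
      case 0
      from J[OF PrimRec(3) 0] have "fact_code (pcode f) (list_encode bs) y \<in> S"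
        by (auto simp: justified_def)
      from PrimRec(1)[OF PrimRec(3) this] show ?case by (rule eval_PrimRec_0)
    next
      case (Suc m)
      from J[OF PrimRec(3) Suc(2)] obtain r where r:
        "fact_code (pcode (PrimRec f g)) (list_encode (m # bs)) r \<in> S"
        "fact_code (pcode g) (list_encode (m # r # bs)) y \<in> S"
        by (auto simp: justified_def)
      from eval_PrimRec_Suc[OF Suc(1)[OF r(1)] PrimRec(2)[OF PrimRec(3) r(2)]] show ?case by simp
    qed
    from J[OF PrimRec(3,4)] obtain m b where "xs = m # list_decode b"
      by (auto simp: justified_def list_encode_eq_cons)
    with rec PrimRec(4) show ?case by blast
  next
    case (Mu f)
    from J[OF Mu(2,3)] have
      "fact_code (pcode f) (list_encode (y # xs)) 0 \<in> S"
      "\<forall>i<y. \<exists>v. fact_code (pcode f) (list_encode (i # xs)) (Suc v) \<in> S"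
      by (auto simp: justified_def)
    then have "eval {} f (y # xs) 0 {}" "\<forall>i<y. \<exists>v. eval {} f (i # xs) (Suc v) {}"
      using Mu(1)[OF Mu(2)] by blast+
    then show ?case using eval_Mu[of y "{}" f xs _ "\<lambda>_. {}" "{}"] by (auto simp: choice_iff')
  next
    case Oracle
    from J[OF Oracle] show ?case by (auto simp: justified_def)
  }
qed

section \<open>Finite certificates of computations\<close>

definition derivable :: "nat \<Rightarrow> nat \<Rightarrow> nat \<Rightarrow> bool" where
  "derivable c a y \<longleftrightarrow> (\<exists>S. finite S \<and> closed_facts S \<and> fact_code c a y \<in> S)"

text \<open>Certificates of the premises are united and the new fact is added; closure survives
  because \<open>justified\<close> is monotone in the set.\<close>

lemma derivableI:
  assumes T: "finite T" "\<And>c a y. fact_code c a y \<in> T \<Longrightarrow> derivable c a y"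
    and j: "justified UNIV T c a y"
  shows "derivable c a y"
proof -
  have "\<exists>S. finite S \<and> closed_facts S \<and> t \<in> S" if "t \<in> T" for t
    using T(2) that by (metis derivable_def prod_decode_inverse surj_pair)
  then obtain F where F: "\<And>t. t \<in> T \<Longrightarrow> finite (F t) \<and> closed_facts (F t) \<and> t \<in> F t" by metis
  let ?S = "insert (fact_code c a y) (\<Union>t\<in>T. F t)"
  have "closed_facts ?S"
    unfolding closed_facts_def
  proof (intro allI impI)
    fix c' a' y' assume "fact_code c' a' y' \<in> ?S"
    then consider "fact_code c' a' y' = fact_code c a y" | t where "t \<in> T" "fact_code c' a' y' \<in> F t"
      by blast
    then show "justified UNIV ?S c' a' y'"
    proof cases
      case 1
      have "T \<subseteq> ?S" using F by blast
      then show ?thesis using 1 justified_mono[OF j] by simp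
    next
      case 2
      then have "justified UNIV (F t) c' a' y'" using F by (auto simp: closed_facts_def)
      then show ?thesis by (rule justified_mono) (use 2 in auto)
    qed
  qed
  moreover have "finite ?S" using T(1) F by auto
  ultimately show ?thesis unfolding derivable_def by blast
qed

lemma derivable_Proj: "i < length xs \<Longrightarrow> derivable \<langle>2,i\<rangle> (list_encode xs) (xs ! i)"
proof (induction i arbitrary: xs)
  case 0
  then obtain x xs' where xs: "xs = x # xs'" by (cases xs) auto
  show ?case unfolding xs by (rule derivableI[of "{}"]) (simp_all add: justified_def)
next
  case (Suc i)
  then obtain x xs' where xs: "xs = x # xs'" by (cases xs) auto
  have IH: "derivable \<langle>2,i\<rangle> (list_encode xs') (xs' ! i)" using Suc xs by simp
  show ?case unfolding xs
    by (rule derivableI[of "{fact_code \<langle>2,i\<rangle> (list_encode xs') (xs' ! i)}"])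
      (use IH in \<open>simp_all add: justified_def\<close>)
qed

lemma derivable_list:
  "\<lbrakk>length ys = length gs; \<forall>i<length gs. derivable (pcode (gs ! i)) a (ys ! i)\<rbrakk>
   \<Longrightarrow> derivable \<langle>6,list_encode (map pcode gs)\<rangle> a (list_encode ys)"
proof (induction gs arbitrary: ys)
  case Nil
  then show ?case by - (rule derivableI[of "{}"], auto simp: justified_def)
next
  case (Cons g gs)
  then obtain u v where ys: "ys = u # v" by (cases ys) auto
  have "derivable (pcode g) a u" "derivable \<langle>6,list_encode (map pcode gs)\<rangle> a (list_encode v)"
    using Cons(1)[of v] Cons(2,3) unfolding ys by (auto simp: All_less_Suc2)
  then show ?case unfolding ys
    by - (rule derivableI[of "{fact_code (pcode g) a u,
          fact_code \<langle>6,list_encode (map pcode gs)\<rangle> a (list_encode v)}"], auto simp: justified_def)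
qed

lemma derivable_complete:
  "eval B p xs y Q \<Longrightarrow> oracle_free p \<Longrightarrow> derivable (pcode p) (list_encode xs) y"
proof (induction rule: eval.induct)
  case (eval_Zero xs)
  then show ?case by - (rule derivableI[of "{}"], auto simp: justified_def)
next
  case (eval_Succ x)
  then show ?case by - (rule derivableI[of "{}"], auto simp: justified_def)
next
  case (eval_Proj i xs)
  then show ?case by (auto intro: derivable_Proj)
next
  case (eval_Comp ys gs xs Qs f z Q)
  then have "derivable \<langle>6,list_encode (map pcode gs)\<rangle> (list_encode xs) (list_encode ys)"
    "derivable (pcode f) (list_encode ys) z"
    by (auto intro: derivable_list)
  then show ?case
    by - (rule derivableI[of "{fact_code \<langle>6,list_encode (map pcode gs)\<rangle> (list_encode xs) (list_encode ys),
          fact_code (pcode f) (list_encode ys) z}"], auto simp: justified_def)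
next
  case (eval_PrimRec_0 f xs y Q g)
  then show ?case
    by - (rule derivableI[of "{fact_code (pcode f) (list_encode xs) y}"], auto simp: justified_def)
next
  case (eval_PrimRec_Suc f g n xs r Q y Q')
  then show ?case
    by - (rule derivableI[of "{fact_code (pcode (PrimRec f g)) (list_encode (n # xs)) r,
          fact_code (pcode g) (list_encode (n # r # xs)) y}"], auto simp: justified_def)
next
  case (eval_Mu n f xs vs Qs Q)
  then show ?case
    by - (rule derivableI[of "insert (fact_code (pcode f) (list_encode (n # xs)) 0)
          ((\<lambda>i. fact_code (pcode f) (list_encode (i # xs)) (Suc (vs i))) ` {..<n})"], auto simp: justified_def)
qed auto

section \<open>Decidability of certificates and enumeration by stages\<close>

definition valid :: "nat \<Rightarrow> bool" where
  "valid w \<longleftrightarrow> (\<forall>c<w. \<forall>a<w. \<forall>y<w.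
     fact_code c a y \<in> set_decode w \<longrightarrow> justified {..<w} (set_decode w) c a y)"

lemma in_set_decode_less: "x \<in> set_decode w \<Longrightarrow> x < w"
proof -
  assume "x \<in> set_decode w"
  then have "w div 2 ^ x \<noteq> 0" by (auto simp: set_decode_def elim: oddE)
  then have "2 ^ x \<le> w" by (metis div_less not_le)
  then show "x < w" using less_exp[of x] by linarith
qed

lemma pair_less: "\<langle>x,y\<rangle> < w \<Longrightarrow> x < w \<and> y < w"
  using le_prod_encode_1[of x y] le_prod_encode_2[of y x] by linarith

text \<open>Members of \<open>set_decode w\<close>, and the components of the pairs they code, are
  below \<open>w\<close>. All witnesses in a justification are components of facts in the
  set.\<close>

lemma valid_iff: "valid w \<longleftrightarrow> closed_facts (set_decode w)"
proof -
  have 1: "c < w \<and> a < w \<and> y < w" if "fact_code c a y \<in> set_decode w" for c a y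
    using in_set_decode_less[OF that] by (auto dest!: pair_less)
  have 2: "justified {..<w} (set_decode w) c a y"
    if j: "justified UNIV (set_decode w) c a y" and f: "fact_code c a y \<in> set_decode w" for c a y
    using j 1[OF f] unfolding justified_def
    apply (elim disj_forward)
    subgoal by simp
    subgoal by (auto dest: 1 dest!: pair_less Suc_lessD)
    subgoal by (auto dest: 1 dest!: pair_less Suc_lessD)
    subgoal by (auto dest: 1 dest!: pair_less Suc_lessD)
    subgoal by (fastforce dest: 1 dest!: pair_less Suc_lessD)
    subgoal by simp
    subgoal by (auto dest: 1 dest!: pair_less Suc_lessD)
    subgoal by (fastforce dest: 1 dest!: pair_less Suc_lessD)
    subgoal by (fastforce dest: 1 dest!: pair_less Suc_lessD)
    done
  show ?thesis unfolding valid_def closed_facts_def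
    using 1 2 justified_mono[of "{..<w}" "set_decode w" _ _ _ UNIV] by blast
qed

lemmas rp_logic = rp_conj rp_disj rp_imp rp_not rp_ex_less rp_all_less rp_ex_le rp_all_le
  rp_bex_less rp_eq rp_le rp_less rp_const rp_in_set_decode
  rc_pair rc_add rc_mult rc_Suc rc_const rc_proj

lemma rp_valid: "rp (\<lambda>e. valid (e 0))"
  unfolding valid_def justified_def by (intro rp_logic)

text \<open>The stagewise form of \<open>W\<^sub>e\<close>, with \<open>s\<close> bounding the
  certificate. Output 1, not halting, marks membership, so a program for a characteristic function
  enumerates its own set.\<close>

definition enumerated :: "nat \<Rightarrow> nat \<Rightarrow> nat \<Rightarrow> bool" where
  "enumerated e x s \<longleftrightarrow> (\<exists>w\<le>s. valid w \<and> fact_code e (list_encode [x]) 1 \<in> set_decode w)"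

lemma rp_enumerated: "rc E \<Longrightarrow> rc E' \<Longrightarrow> rc E'' \<Longrightarrow> rp (\<lambda>e. enumerated (E e) (E' e) (E'' e))"
proof (rule rp_app3)
  show "rp (\<lambda>e. enumerated (e 0) (e 1) (e 2))"
    unfolding enumerated_def list_encode.simps by (intro rp_logic rp_app1[OF rp_valid])
qed

lemma enumerated_mono: "enumerated e x s \<Longrightarrow> s \<le> s' \<Longrightarrow> enumerated e x s'"
  unfolding enumerated_def by (meson order_trans)

lemma enumerated_universal:
  assumes "recursive_set A"
  shows "\<exists>e. \<forall>x. x \<in> A \<longleftrightarrow> (\<exists>s. enumerated e x s)"
proof -
  from assms obtain p where p: "oracle_free p" "\<And>n. eval {} p [n] (of_bool (n \<in> A)) {}"
    by (auto simp: recursive_set_def recursive_fun_def)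
  have "x \<in> A \<longleftrightarrow> (\<exists>s. enumerated (pcode p) x s)" for x
  proof
    assume "x \<in> A"
    then have "derivable (pcode p) (list_encode [x]) 1"
      using derivable_complete[OF p(2)[of x] p(1)] by simp
    then obtain S where S: "finite S" "closed_facts S" "fact_code (pcode p) (list_encode [x]) 1 \<in> S"
      by (auto simp: derivable_def)
    then have "enumerated (pcode p) x (set_encode S)"
      unfolding enumerated_def valid_iff by (intro exI[of _ "set_encode S"]) simp
    then show "\<exists>s. enumerated (pcode p) x s" ..
  next
    assume "\<exists>s. enumerated (pcode p) x s"
    then have "eval {} p [x] 1 {}" unfolding enumerated_def valid_iff using closed_facts_sound by blast
    from eval_deterministic[OF this p(2)] show "x \<in> A" by (simp add: of_bool_def split: if_splits)
  qed
  then show ?thesis by blast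
qed

lemma rc_fst: assumes "rc E" shows "rc (\<lambda>e. fst (prod_decode (E e)))"
proof -
  have bound: "\<exists>y\<le>z. z = \<langle>fst (prod_decode z),y\<rangle>" for z
    by (metis le_prod_encode_2 prod.collapse prod_decode_inverse)
  have fst: "(LEAST x. \<exists>y\<le>z. z = \<langle>x,y\<rangle>) = fst (prod_decode z)" for z
    by (rule Least_equality) (use bound in auto)
  have "rc (\<lambda>e. LEAST x. \<exists>y\<le>e 0. e 0 = \<langle>x,y\<rangle>)"
    by (intro rc_Least rp_logic) (use bound in blast)
  from rc_app1[OF this[unfolded fst] assms] show ?thesis .
qed

lemma rc_snd: assumes "rc E" shows "rc (\<lambda>e. snd (prod_decode (E e)))"
proof -
  have bound: "\<exists>x\<le>z. z = \<langle>x,snd (prod_decode z)\<rangle>" for z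
    by (metis le_prod_encode_1 prod.collapse prod_decode_inverse)
  have snd: "(LEAST y. \<exists>x\<le>z. z = \<langle>x,y\<rangle>) = snd (prod_decode z)" for z
    by (rule Least_equality) (use bound in auto)
  have "rc (\<lambda>e. LEAST y. \<exists>x\<le>e 0. e 0 = \<langle>x,y\<rangle>)"
    by (intro rc_Least rp_logic) (use bound in blast)
  from rc_app1[OF this[unfolded snd] assms] show ?thesis .
qed

lemma re_set_projection:
  assumes P: "rp (\<lambda>e. P (e 0) (e 1))"
  shows "re_set {x. \<exists>s. P x s}"
proof (cases "{x. \<exists>s. P x s} = {}")
  case False
  then obtain a s0 where a: "P a s0" by blast
  \<comment> \<open>\<open>z\<close> codes a candidate and a stage; if the stage is no witness, the
    default member \<open>a\<close> is output.\<close>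
  define g where "g z = (if P (fst (prod_decode z)) (snd (prod_decode z)) then fst (prod_decode z) else a)" for z
  have "recursive_fun g"
    unfolding recursive_fun_rc g_def
    by (intro rc_if rp_app2[OF P] rc_fst rc_snd rc_const rc_proj)
  moreover have "{x. \<exists>s. P x s} = range g"
  proof (intro equalityI subsetI)
    fix x assume "x \<in> {x. \<exists>s. P x s}"
    then obtain s where "P x s" by blast
    then have "g \<langle>x,s\<rangle> = x" by (simp add: g_def)
    then show "x \<in> range g" by (metis rangeI)
  qed (use a in \<open>auto simp: g_def\<close>)
  ultimately show ?thesis by (auto simp: re_set_def)
qed (simp add: re_set_def)

lemma rp_in_finite: "finite F \<Longrightarrow> rp (\<lambda>e. e 0 \<in> F)"
proof (induction rule: finite_induct)
  case (insert a F)
  have "rp (\<lambda>e. e 0 = a \<or> e 0 \<in> F)" by (intro rp_logic insert.IH)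
  then show ?case by simp
qed (simp add: rp_const)

section \<open>The construction\<close>

text \<open>When \<open>enumerated i\<close> is the graph of a function \<open>p\<close>, \<open>converged i k s\<close> says that \<open>p 0, \<dots>, p k\<close> are all
  enumerated by stage \<open>s\<close>. The first such \<open>s\<close> bounds \<open>p k\<close>, and so it can replace \<open>p k\<close>.\<close>

definition converged :: "nat \<Rightarrow> nat \<Rightarrow> nat \<Rightarrow> bool" where
  "converged i k s \<longleftrightarrow> (\<forall>k'\<le>k. \<exists>y\<le>s. enumerated i \<langle>k',y\<rangle> s)"

lemma rp_converged: "rc E \<Longrightarrow> rc E' \<Longrightarrow> rc E'' \<Longrightarrow> rp (\<lambda>e. converged (E e) (E' e) (E'' e))"
proof (rule rp_app3)
  show "rp (\<lambda>e. converged (e 0) (e 1) (e 2))"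
    unfolding converged_def by (intro rp_logic rp_enumerated)
qed

lemma converged_mono: "converged i k s \<Longrightarrow> k' \<le> k \<Longrightarrow> s \<le> s' \<Longrightarrow> converged i k' s'"
  unfolding converged_def by (meson enumerated_mono order_trans)

lemma converged_dominates:
  assumes p: "rc (\<lambda>e. p (e 0))"
  shows "\<exists>i. (\<forall>k. \<exists>s. converged i k s) \<and> (\<forall>k s. converged i k s \<longrightarrow> p k \<le> s)"
proof -
  have "rp (\<lambda>e. \<exists>k\<le>e 0. e 0 = \<langle>k,p k\<rangle>)" by (intro rp_logic rc_app1[OF p])
  then have "recursive_set {z. \<exists>k\<le>z. z = \<langle>k,p k\<rangle>}" by (simp add: recursive_set_rp)
  from enumerated_universal[OF this] obtain i where
    "\<And>z. (\<exists>k\<le>z. z = \<langle>k,p k\<rangle>) \<longleftrightarrow> (\<exists>s. enumerated i z s)" by auto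
  then have i: "(\<exists>s. enumerated i \<langle>k,y\<rangle> s) \<longleftrightarrow> y = p k" for k y
    by (metis Pair_inject le_prod_encode_1 prod_encode_eq)
  have "\<exists>s. converged i k s" for k
  proof (induction k)
    case 0
    obtain s where "enumerated i \<langle>0,p 0\<rangle> s" using i by blast
    then have "enumerated i \<langle>0,p 0\<rangle> (s + p 0)" by (rule enumerated_mono) simp
    then have "converged i 0 (s + p 0)" by (auto simp: converged_def intro!: exI[of _ "p 0"])
    then show ?case ..
  next
    case (Suc k)
    then obtain s' where s': "converged i k s'" ..
    obtain s where "enumerated i \<langle>Suc k,p (Suc k)\<rangle> s" using i by blast
    \<comment> \<open>The stage is enlarged by \<open>p (Suc k)\<close> because
      \<open>converged\<close> also bounds the value by the stage, and by \<open>s'\<close> to keep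
      the earlier arguments.\<close>
    then have "enumerated i \<langle>Suc k,p (Suc k)\<rangle> (s + p (Suc k) + s')" by (rule enumerated_mono) simp
    moreover have "converged i k (s + p (Suc k) + s')" by (rule converged_mono[OF s']) auto
    ultimately have "converged i (Suc k) (s + p (Suc k) + s')"
      unfolding converged_def by (metis le_SucE le_add1 le_add2 order_trans)
    then show ?case ..
  qed
  moreover have "p k \<le> s" if c: "converged i k s" for k s
  proof -
    obtain y where "y \<le> s" "enumerated i \<langle>k,y\<rangle> s" using c unfolding converged_def by blast
    then show ?thesis using i[of k y] by blast
  qed
  ultimately show ?thesis by blast
qed

text \<open>Totality of the \<open>i\<close>-th function is not decidable, but only the existence of
  a recursive \<open>t\<close> is claimed, so a case distinction suffices.\<close>

lemma converged_modulus:
  "\<exists>t. rc (\<lambda>e. t (e 0)) \<and> (\<forall>k k' s. k' \<le> k \<longrightarrow> converged i k' s \<longrightarrow> converged i k' (t k))"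
proof (cases "\<forall>k. \<exists>s. converged i k s")
  case True
  have "rc (\<lambda>e. LEAST s. converged i (e 0) s)"
    by (intro rc_Least rp_converged rc_proj rc_const) (use True in blast)
  moreover have "converged i k' (LEAST s. converged i k s)" if "k' \<le> k" for k k'
    by (rule converged_mono[OF LeastI_ex that order_refl]) (use True in blast)
  ultimately show ?thesis by (intro exI[of _ "\<lambda>k. LEAST s. converged i k s"]) auto
next
  case False
  \<comment> \<open>\<open>K\<close> is the first argument at which convergence fails forever. Only
    arguments below \<open>K\<close> ever converge, all by one stage \<open>c\<close>, which is
    arbitrary if \<open>K = 0\<close>.\<close>
  define K where "K = (LEAST k. \<not> (\<exists>s. converged i k s))"
  have K: "\<not> (\<exists>s. converged i K s)" unfolding K_def by (rule LeastI_ex) (use False in blast)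
  obtain c where c: "0 < K \<Longrightarrow> converged i (K - 1) c"
    using not_less_Least[of "K - 1" "\<lambda>k. \<not> (\<exists>s. converged i k s)"] unfolding K_def[symmetric]
    by (cases K) auto
  have "converged i k' c" if "converged i k' s" for k' s
  proof -
    have "k' < K" using that K converged_mono by (meson not_le order_refl)
    then show ?thesis by (intro converged_mono[OF c]) auto
  qed
  then show ?thesis using rc_const by (intro exI[of _ "\<lambda>_. c"]) blast
qed

text \<open>With the first stage of convergence in place of the value at \<open>k'\<close>,
  \<open>converged i k' x\<close> says that this value is at most \<open>x\<close>.\<close>

definition permits :: "nat \<Rightarrow> nat \<Rightarrow> nat \<Rightarrow> nat \<Rightarrow> bool" where
  "permits e x k s \<longleftrightarrow> (\<forall>i<e. \<forall>k'\<le>k. converged i k' s \<longrightarrow> converged i k' x)"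

lemma permits_bound:
  "\<exists>g. rc (\<lambda>e. g (e 0)) \<and> (\<forall>k x s. g k \<le> x \<longrightarrow> permits e x k s)"
proof (induction e)
  case 0
  then show ?case by (auto simp: permits_def intro: exI[of _ "\<lambda>_. 0"] rc_const)
next
  case (Suc e)
  then obtain g where g: "rc (\<lambda>e. g (e 0))" "\<And>k x s. g k \<le> x \<Longrightarrow> permits e x k s" by blast
  obtain t where t: "rc (\<lambda>e. t (e 0))" "\<And>k k' s. k' \<le> k \<Longrightarrow> converged e k' s \<Longrightarrow> converged e k' (t k)"
    using converged_modulus by blast
  \<comment> \<open>The modulus of the new index \<open>e\<close> is added to the old bound.\<close>
  have "permits (Suc e) x k s" if "g k + t k \<le> x" for k x s
    unfolding permits_def
  proof (intro allI impI)
    fix i k' assume *: "i < Suc e" "k' \<le> k" "converged i k' s"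
    show "converged i k' x"
    proof (cases "i = e")
      case True
      then show ?thesis using * t(2) converged_mono[of e k' "t k" k' x] that by auto
    next
      case False
      then show ?thesis using * g(2)[of k x s] that by (auto simp: permits_def)
    qed
  qed
  then show ?case using rc_add[OF g(1) t(1)] by (intro exI[of _ "\<lambda>k. g k + t k"]) auto
qed

context
  fixes f :: "nat \<Rightarrow> nat"
  assumes f: "rc (\<lambda>e. f (e 0))"
begin

definition eligible :: "nat \<Rightarrow> nat \<Rightarrow> nat \<Rightarrow> bool" where
  "eligible e s y \<longleftrightarrow> enumerated e \<langle>e,y\<rangle> s \<and> (\<forall>s'<s. f s' \<noteq> f s) \<and> permits e \<langle>e,y\<rangle> (f s) s"

text \<open>Choosing the pair of least code makes each requirement act at most once. The bounds on
  \<open>s'\<close> and \<open>y'\<close> follow from the comparison of codes and keep the relation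
  decidable.\<close>

definition acts :: "nat \<Rightarrow> nat \<Rightarrow> nat \<Rightarrow> bool" where
  "acts e s y \<longleftrightarrow> eligible e s y \<and>
     (\<forall>s'\<le>\<langle>s,y\<rangle>. \<forall>y'\<le>\<langle>s,y\<rangle>. \<langle>s',y'\<rangle> < \<langle>s,y\<rangle> \<longrightarrow> \<not> eligible e s' y')"

definition enters :: "nat \<Rightarrow> nat \<Rightarrow> bool" where
  "enters x s \<longleftrightarrow> (\<exists>e\<le>x. \<exists>y\<le>x. x = \<langle>e,y\<rangle> \<and> acts e s y)"

lemma rp_eligible: "rp (\<lambda>e. eligible (e 0) (e 1) (e 2))"
  unfolding eligible_def permits_def by (intro rp_logic rp_enumerated rp_converged rc_app1[OF f])

lemma rp_enters: "rp (\<lambda>e. enters (e 0) (e 1))"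
  unfolding enters_def acts_def by (intro rp_logic rp_app3[OF rp_eligible])

lemma enters_pair: "enters \<langle>e,y\<rangle> s \<longleftrightarrow> acts e s y"
  using le_prod_encode_1 le_prod_encode_2 by (auto simp: enters_def)

lemma acts_minimal: "acts e s y \<Longrightarrow> eligible e s' y' \<Longrightarrow> \<langle>s,y\<rangle> \<le> \<langle>s',y'\<rangle>"
  unfolding acts_def by (meson le_prod_encode_1 le_prod_encode_2 not_le order_trans less_imp_le)

lemma acts_unique: "acts e s y \<Longrightarrow> acts e s' y' \<Longrightarrow> s' = s \<and> y' = y"
  using acts_minimal[of e s y s' y'] acts_minimal[of e s' y' s y]
  by (metis Pair_inject acts_def order_antisym prod_encode_eq)

lemma acts_exists:
  assumes "eligible e s y" shows "\<exists>s y. acts e s y"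
proof -
  let ?P = "\<lambda>n. \<exists>s y. n = \<langle>s,y\<rangle> \<and> eligible e s y"
  have "?P (LEAST n. ?P n)" by (rule LeastI_ex) (use assms in blast)
  then obtain s y where sy: "(LEAST n. ?P n) = \<langle>s,y\<rangle>" "eligible e s y" by blast
  have "\<not> eligible e s' y'" if "\<langle>s',y'\<rangle> < \<langle>s,y\<rangle>" for s' y'
    using not_less_Least[of _ ?P] that unfolding sy(1) by blast
  then show ?thesis using sy(2) unfolding acts_def by blast
qed

section \<open>The diagonal set is r.e. and nonrecursive\<close>

definition diag_set :: "nat set" where
  "diag_set = {x. \<exists>s. enters x s}"

lemma re_set_diag_set: "re_set diag_set"
  unfolding diag_set_def by (rule re_set_projection) (rule rp_enters)

lemma pair_in_diag_set: "\<langle>e,y\<rangle> \<in> diag_set \<longleftrightarrow> (\<exists>s. acts e s y)"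
  unfolding diag_set_def mem_Collect_eq enters_pair ..

lemma nonrecursive_diag_set:
  assumes B: "\<not> recursive_set (range f)"
  shows "\<not> recursive_set diag_set"
proof
  assume "recursive_set diag_set"
  then have "recursive_set (- diag_set)" unfolding recursive_set_rp using rp_not by force
  from enumerated_universal[OF this] obtain e where e: "\<And>x. x \<notin> diag_set \<longleftrightarrow> (\<exists>s. enumerated e x s)" by auto
  \<comment> \<open>Eligibility would lead to an action, placing a number in \<open>diag_set\<close>
    that is also enumerated into its complement.\<close>
  have no: "\<not> eligible e s y" for s y
  proof
    assume "eligible e s y"
    from acts_exists[OF this] obtain s y where a: "acts e s y" by blast
    then have "\<langle>e,y\<rangle> \<in> diag_set" "enumerated e \<langle>e,y\<rangle> s" by (auto simp: pair_in_diag_set acts_def eligible_def)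
    then show False using e by blast
  qed
  then have "\<langle>e,y\<rangle> \<notin> diag_set" for y by (auto simp: pair_in_diag_set acts_def)
  then have enum: "\<exists>s. enumerated e \<langle>e,y\<rangle> s" for y using e by blast
  obtain g where g: "rc (\<lambda>e. g (e 0))" "\<And>k x s. g k \<le> x \<Longrightarrow> permits e x k s"
    using permits_bound by blast
  \<comment> \<open>By the choice of \<open>g\<close>, \<open>k\<close> always permits
    \<open>\<langle>e,g k\<rangle>\<close>. As nothing is eligible, \<open>k\<close> cannot be new
    at a stage from \<open>m k\<close> on, so a search below \<open>m k\<close> decides whether
    \<open>k\<close> is in the range.\<close>
  define m where "m k = (LEAST s. enumerated e \<langle>e,g k\<rangle> s)" for k
  have m: "enumerated e \<langle>e,g k\<rangle> (m k)" for k unfolding m_def by (rule LeastI_ex) (rule enum)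
  have rc_m: "rc (\<lambda>e. m (e 0))"
    unfolding m_def by (intro rc_Least rp_enumerated rp_logic rc_app1[OF g(1)] enum)
  have "k \<in> range f \<longleftrightarrow> (\<exists>s<m k. f s = k)" for k
  proof
    assume "k \<in> range f"
    then have ex: "\<exists>s. f s = k" by auto
    define s where "s = (LEAST s. f s = k)"
    have s: "f s = k" unfolding s_def using ex by (rule LeastI_ex)
    have "\<forall>s'<s. f s' \<noteq> f s" using not_less_Least s unfolding s_def by auto
    moreover have "permits e \<langle>e,g k\<rangle> (f s) s" unfolding s by (rule g(2)) (rule le_prod_encode_2)
    ultimately have "\<not> enumerated e \<langle>e,g k\<rangle> s" using no[of s "g k"] unfolding eligible_def by blast
    then have "s < m k" using enumerated_mono[OF m] by (meson not_le)
    then show "\<exists>s<m k. f s = k" using s by blast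
  qed auto
  moreover have "rp (\<lambda>e. \<exists>s<m (e 0). f s = e 0)"
    by (intro rp_logic rc_app1[OF f] rc_app1[OF rc_m])
  ultimately show False using B by (simp add: recursive_set_rp)
qed

section \<open>The reduction with small use\<close>

lemma settled:
  assumes h: "mono h" and p: "\<And>k. k < h (p k)"
    and i: "\<And>k s. converged i k s \<Longrightarrow> p k \<le> s"
    and t: "converged i (h x) t" "t \<le> s0"
    and B: "\<And>j. j < h x \<Longrightarrow> j \<in> range f \<Longrightarrow> \<exists>s<s0. f s = j"
    and x: "enters x s" "s0 \<le> s"
  shows "fst (prod_decode x) \<le> i"
proof (rule ccontr)
  obtain e y where xe: "x = \<langle>e,y\<rangle>" and a: "acts e s y" using x(1) by (auto simp: enters_def)
  assume "\<not> fst (prod_decode x) \<le> i"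
  then have ie: "i < e" by (simp add: xe)
  have new: "\<forall>s'<s. f s' \<noteq> f s" and per: "permits e x (f s) s"
    using a by (auto simp: acts_def eligible_def xe)
  \<comment> \<open>All elements of \<open>range f\<close> below \<open>h x\<close> have appeared
    before \<open>s0\<close>, whereas \<open>f s\<close> is new.\<close>
  have "\<not> f s < h x"
  proof
    assume "f s < h x"
    then obtain s' where "s' < s0" "f s' = f s" using B[of "f s"] by auto
    then show False using new x(2) by auto
  qed
  moreover have "converged i (h x) s" by (rule converged_mono[OF t(1)]) (use t(2) x(2) in auto)
  \<comment> \<open>Permission applies at \<open>k' = h x \<le> f s\<close>. The resulting bound
    \<open>p (h x) \<le> x\<close> contradicts that \<open>p\<close> inverts
    \<open>h\<close>.\<close>
  ultimately have "converged i (h x) x" using per ie by (auto simp: permits_def)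
  then have "p (h x) \<le> x" by (rule i)
  then have "h (p (h x)) \<le> h x" by (rule monoD[OF h])
  then show False using p[of "h x"] by simp
qed

text \<open>Each requirement \<open>e\<close> acts at most once, so each column has at most one
  element.\<close>

lemma finite_columns: "finite {x \<in> diag_set. fst (prod_decode x) \<le> i}"
proof (rule finite_imageD)
  show "finite ((\<lambda>x. fst (prod_decode x)) ` {x \<in> diag_set. fst (prod_decode x) \<le> i})"
    by (rule finite_subset[of _ "{..i}"]) auto
  show "inj_on (\<lambda>x. fst (prod_decode x)) {x \<in> diag_set. fst (prod_decode x) \<le> i}"
  proof (rule inj_onI)
    fix x x' assume "x \<in> {x \<in> diag_set. fst (prod_decode x) \<le> i}" "x' \<in> {x \<in> diag_set. fst (prod_decode x) \<le> i}"
      and eq: "fst (prod_decode x) = fst (prod_decode x')"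
    then obtain s e y s' e' y' where "x = \<langle>e,y\<rangle>" "acts e s y" "x' = \<langle>e',y'\<rangle>" "acts e' s' y'"
      by (auto simp: diag_set_def enters_def)
    then show "x = x'" using eq acts_unique[of e s y s' y'] by auto
  qed
qed

lemma tu_reducible_diag_set: "diag_set \<le>\<^sub>T\<^sub>t\<^sub>u range f"
  unfolding tu_reducible_def
proof (intro allI impI)
  fix h assume "order_function h"
  then have h: "rc (\<lambda>e. h (e 0))" and mono: "mono h" and unb: "\<And>k. \<exists>n. k \<le> h n"
    by (auto simp: order_function_def recursive_fun_rc)
  let ?B = "range f"
  define p where "p k = (LEAST n. k < h n)" for k
  have ex: "\<exists>n. k < h n" for k using unb[of "Suc k"] by (auto simp: Suc_le_eq)
  have p: "k < h (p k)" for k unfolding p_def by (rule LeastI_ex) (rule ex)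
  have "rc (\<lambda>e. p (e 0))" unfolding p_def by (intro rc_Least rp_logic rc_app1[OF h] ex)
  from converged_dominates[OF this] obtain i where
    tot: "\<And>k. \<exists>s. converged i k s" and i: "\<And>k s. converged i k s \<Longrightarrow> p k \<le> s" by blast
  define t where "t k = (LEAST s. converged i k s)" for k
  have t: "converged i k (t k)" for k unfolding t_def by (rule LeastI_ex) (rule tot)
  have rc_t: "rc (\<lambda>e. t (e 0))" unfolding t_def by (intro rc_Least rp_converged rp_logic tot)
  \<comment> \<open>\<open>l j\<close> is a stage listing \<open>j\<close> if
    \<open>j \<in> ?B\<close>, and 0 otherwise. The nested \<open>of_bool\<close> reproduces the
    value that the program \<open>pb\<close> below returns on the oracle's answer, so that
    \<open>eval_Mu_pure\<close> fits.\<close>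
  define l where "l j = (LEAST s. of_bool (\<not> (of_bool (j \<in> ?B) = (0::nat) \<or> f s = j)) = (0::nat))" for j
  have exl: "\<exists>s. of_bool (\<not> (of_bool (j \<in> ?B) = (0::nat) \<or> f s = j)) = (0::nat)" for j
    by auto
  have l: "f (l j) = j" if "j \<in> ?B" for j
    using LeastI_ex[OF exl[of j]] that unfolding l_def[symmetric] by auto
  define F where "F = {x \<in> diag_set. fst (prod_decode x) \<le> i}"
  \<comment> \<open>The finite set \<open>F\<close> of exceptions is built into the program.
    \<open>r\<close> will be the sum of \<open>Suc (l j)\<close> over \<open>j < h x\<close>, where
    \<open>Suc\<close> puts each \<open>l j\<close> strictly below it.\<close>
  let ?D = "\<lambda>x r. x \<in> F \<or> (\<exists>s<r + t (h x). enters x s)"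
  have D: "?D x (\<Sum>j<h x. Suc (l j)) \<longleftrightarrow> x \<in> diag_set" for x
  proof
    assume "x \<in> diag_set"
    then obtain s where s: "enters x s" by (auto simp: diag_set_def)
    let ?s0 = "(\<Sum>j<h x. Suc (l j)) + t (h x)"
    have "l j < ?s0" if "j < h x" for j
      using member_le_sum[of j "{..<h x}" "\<lambda>j. Suc (l j)"] that by simp
    then have "fst (prod_decode x) \<le> i" if "?s0 \<le> s"
      using l by (intro settled[OF mono p i t _ _ s that]) auto
    then show "?D x (\<Sum>j<h x. Suc (l j))"
      using \<open>x \<in> diag_set\<close> s by (cases "?s0 \<le> s") (auto simp: F_def)
  qed (auto simp: F_def diag_set_def)
  have "rp (\<lambda>e. ?D (e 0) (e 1))"
    by (intro rp_logic rp_app1[OF rp_in_finite] rp_app2[OF rp_enters] rc_app1[OF rc_t] rc_app1[OF h])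
      (simp add: F_def finite_columns)
  from rc_program[OF this[unfolded rp_def], of 1] obtain pd where
    "\<And>xs. length xs = 2 \<Longrightarrow> eval ?B pd xs (of_bool (?D (xs ! 0) (xs ! 1))) {}"
    by (auto simp: numeral_2_eq_2)
  from this[of "[_, _]"] have pd: "eval ?B pd [x, r] (of_bool (?D x r)) {}" for x r by simp
  from rc_program[OF h, of 0] obtain ph where
    "\<And>xs. length xs = 1 \<Longrightarrow> eval ?B ph xs (h (xs ! 0)) {}" by auto
  from this[of "[_]"] have ph: "eval ?B ph [x] (h x) {}" for x by simp
  have "rc (\<lambda>e. e 0 + Suc (e 1))" by (intro rp_logic)
  from rc_program[OF this, of 1] obtain pa where
    "\<And>xs. length xs = 2 \<Longrightarrow> eval ?B pa xs (xs ! 0 + Suc (xs ! 1)) {}"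
    by (auto simp: numeral_2_eq_2)
  from this[of "[_, _]"] have pa: "eval ?B pa [x, y] (x + Suc y) {}" for x y by simp
  have "rp (\<lambda>e. \<not> (e 2 = 0 \<or> f (e 0) = e 1))" by (intro rp_logic rc_app1[OF f])
  from rc_program[OF this[unfolded rp_def], of 2] obtain pb where
    "\<And>xs. length xs = 3 \<Longrightarrow>
       eval ?B pb xs (of_bool (\<not> (xs ! 2 = 0 \<or> f (xs ! 0) = xs ! 1))) {}"
    by (auto simp: numeral_3_eq_3)
  from this[of "[_, _, _]"]
  have pb: "eval ?B pb [s, j, q] (of_bool (\<not> (q = 0 \<or> f s = j))) {}" for s j q by simp
  \<comment> \<open>Query \<open>j\<close>, search for a stage listing it (ending at 0 at once if
    the answer is 0), and add the successor of the result to \<open>r\<close>.\<close>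
  let ?step = "Comp pa [Proj 1, Comp (Mu pb) [Proj 0, Comp Oracle [Proj 0]]]"
  have P0: "eval ?B (Proj 0) (x # xs) x {}" for x xs
    using eval_Proj[of 0 "x # xs" ?B] by simp
  have P1: "eval ?B (Proj 1) (y # x # xs) x {}" for x y xs
    using eval_Proj[of 1 "y # x # xs" ?B] by simp
  have step: "eval ?B ?step [j, r] (r + Suc (l j)) {j}" for j r
  proof -
    have "eval ?B (Comp Oracle [Proj 0]) [j, r] (of_bool (j \<in> ?B)) {j}"
      using eval_Comp1[OF P0 eval_Oracle] by simp
    from eval_Comp2[OF P1 eval_Comp2[OF P0 this eval_Mu_pure[OF pb exl]] pa]
    show ?thesis by (simp add: l_def)
  qed
  have loop: "eval ?B (PrimRec Zero ?step) [k] (\<Sum>j<k. Suc (l j)) {..<k}" for k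
  proof (induction k)
    case 0
    show ?case using eval_PrimRec_0[OF eval_Zero] by simp
  next
    case (Suc k)
    from eval_PrimRec_Suc[OF Suc step] show ?case by (simp add: lessThan_Suc add.commute)
  qed
  define \<Phi> where "\<Phi> = Comp pd [Proj 0, Comp (PrimRec Zero ?step) [ph]]"
  have \<Phi>: "eval ?B \<Phi> [x] (of_bool (x \<in> diag_set)) {..<h x}" for x
    using eval_Comp2[OF P0 eval_Comp1[OF ph loop] pd[of x]] unfolding \<Phi>_def D by simp
  \<comment> \<open>The queries at \<open>m < n\<close> are the numbers below
    \<open>h m \<le> h n\<close>; strictness absorbs the \<open>+ 1\<close> in
    \<open>use\<close>.\<close>
  have "q < h n" if q: "q \<in> queries_upto \<Phi> ?B n" for n q
  proof -
    obtain m y Q where m: "m < n" "eval ?B \<Phi> [m] y Q" "q \<in> Q"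
      using q by (auto simp: queries_upto_def)
    then have "q < h m" using eval_deterministic[OF \<Phi> m(2)] by auto
    then show ?thesis using monoD[OF mono, of m n] m(1) by simp
  qed
  then have "use \<Phi> ?B n \<le> h n" for n
    unfolding use_def using Max_in[OF finite_queries_upto[of \<Phi> ?B n]] by (auto simp: Suc_le_eq)
  then show "\<exists>\<Phi>. turing_reduction \<Phi> diag_set ?B \<and> (\<forall>n. use \<Phi> ?B n \<le> h n)"
    unfolding turing_reduction_def using \<Phi> by blast
qed

end

theorem theorem5p8:
  fixes B :: "nat set"
  assumes "re_set B" and "\<not> recursive_set B"
  shows "\<exists>A :: nat set. re_set A \<and> \<not> recursive_set A \<and> A \<le>\<^sub>T\<^sub>t\<^sub>u B"
proof -
  \<comment> \<open>This rules out \<open>B = {}\<close>, so \<open>B\<close> is the range of a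
    recursive function.\<close>
  have "recursive_set {}" by (simp add: recursive_set_rp rp_const)
  then obtain f where f: "rc (\<lambda>e. f (e 0))" "B = range f"
    using assms by (auto simp: re_set_def recursive_fun_rc)
  then show ?thesis
    using assms(2) re_set_diag_set[OF f(1)] nonrecursive_diag_set[OF f(1)] tu_reducible_diag_set[OF f(1)] by auto
qed

end
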